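(* Let $K$ be a field with $\mathrm{char}(K)\neq2,3$ and let $g_1,g_2$ be binary cubic forms over $K$ with $\mathrm{disc}(g_1)=\mathrm{disc}(g_2)\neq0$. Let $B_{g_1,g_2}(X_1,Y_1,X_2,Y_2)=g_2(X_2,Y_2)G_1(X_1,Y_1)-G_2(X_2,Y_2)g_1(X_1,Y_1)$, where $G_i$ is the cubic covariant of $g_i$. Then the following are equivalent: (1) $B_{g_1,g_2}$ has a bilinear factor (a factor bihomogeneous of degree $1$ in $(X_1,Y_1)$ and degree $1$ in $(X_2,Y_2)$) in $K[X_1,Y_1,X_2,Y_2]$; (2) $g_1$ and $g_2$ are $\mathrm{SL}(2,K)$-equivalent. More precisely, for $M=\begin{pmatrix}r&s\\t&u\end{pmatrix}\in\mathrm{SL}(2,K)$, $B_{g_1,g_2}$ has the factor $-sX_1X_2+rX_1Y_2-uY_1X_2+tY_1Y_2$ (up to scaling) if and only if $g_1=g_2^M$.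
   Context: For $g=aX^3+bX^2Y+cXY^2+dY^3$, $\mathrm{disc}(g)=b^2c^2-4ac^3-4b^3d-27a^2d^2+18abcd$ and the cubic covariant is $G(X,Y)=(2b^3+27a^2d-9abc)X^3+3(b^2c+9abd-6ac^2)X^2Y-3(bc^2+9acd-6b^2d)XY^2-(2c^3+27ad^2-9bcd)Y^3$. The action of $M=\begin{pmatrix}r&s\\t&u\end{pmatrix}\in\mathrm{GL}(2,K)$ is $g^M(X,Y)=\det(M)^{-1}g(rX+tY,sX+uY)$; $g_1,g_2$ are $\mathrm{SL}(2,K)$-equivalent if $g_2=g_1^M$ for some $M\in\mathrm{SL}(2,K)$.
   Formalization: In the "more precisely" clause, "g_1 = g_2^M" is replaced by "g_1 = g_2^M or g_1 = g_2^{-M}": M and -M give the same factor up to scaling but g_2^{-M} = -g_2^M, so the literal clause fails (e.g. g_1 = g_2, M = -I). *)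

theory Defs
  imports "HOL-Analysis.Analysis" "HOL-Computational_Algebra.Computational_Algebra"
begin

text \<open>
  The ring \<open>K[X, Y]\<close> is \<open>K[X][Y]\<close>, so the coefficient of \<open>X ^ i * Y ^ j\<close> in \<open>p\<close> is
  \<open>coeff (coeff p j) i\<close>; likewise \<open>K[X1, Y1, X2, Y2]\<close> is \<open>K[X1][Y1][X2][Y2]\<close>.
\<close>

type_synonym 'a poly2 = "'a poly poly"
type_synonym 'a poly4 = "'a poly poly poly poly"

definition Const_2 :: "'a::comm_ring_1 \<Rightarrow> 'a poly2" where
  "Const_2 c = [:[:c:]:]"

definition Var_X :: "'a::comm_ring_1 poly2" where
  "Var_X = [:[:0, 1:]:]"

definition Var_Y :: "'a::comm_ring_1 poly2" where
  "Var_Y = [:0, 1:]"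

definition Const_4 :: "'a::comm_ring_1 \<Rightarrow> 'a poly4" where
  "Const_4 c = [:[:[:[:c:]:]:]:]"

definition Var_X1 :: "'a::comm_ring_1 poly4" where
  "Var_X1 = [:[:[:[:0, 1:]:]:]:]"

definition Var_Y1 :: "'a::comm_ring_1 poly4" where
  "Var_Y1 = [:[:[:0, 1:]:]:]"

definition Var_X2 :: "'a::comm_ring_1 poly4" where
  "Var_X2 = [:[:0, 1:]:]"

definition Var_Y2 :: "'a::comm_ring_1 poly4" where
  "Var_Y2 = [:0, 1:]"

text \<open>\<open>subst2 h g P Q\<close> is \<open>g(P, Q)\<close>, where \<open>h\<close> embeds the coefficients in the target ring.\<close>

definition subst2 ::
  "('a::comm_ring_1 \<Rightarrow> 'b::comm_ring_1) \<Rightarrow> 'a poly2 \<Rightarrow> 'b \<Rightarrow> 'b \<Rightarrow> 'b" where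
  "subst2 h g P Q = poly (map_poly (\<lambda>q. poly (map_poly h q) P) g) Q"

definition cubic_form :: "'a::comm_ring_1 \<Rightarrow> 'a \<Rightarrow> 'a \<Rightarrow> 'a \<Rightarrow> 'a poly2" where
  "cubic_form a b c d =
     Const_2 a * Var_X ^ 3 + Const_2 b * Var_X ^ 2 * Var_Y
     + Const_2 c * Var_X * Var_Y ^ 2 + Const_2 d * Var_Y ^ 3"

definition binary_cubic_form :: "'a::comm_ring_1 poly2 \<Rightarrow> bool" where
  "binary_cubic_form g \<longleftrightarrow> (\<exists>a b c d. g = cubic_form a b c d)"

text \<open>The following two are meaningful only when \<open>g\<close> is a binary cubic form.\<close>

definition cubic_disc :: "'a::comm_ring_1 poly2 \<Rightarrow> 'a" where
  "cubic_disc g =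
    (let a = coeff (coeff g 0) 3; b = coeff (coeff g 1) 2;
         c = coeff (coeff g 2) 1; d = coeff (coeff g 3) 0
     in b^2 * c^2 - 4 * a * c^3 - 4 * b^3 * d - 27 * a^2 * d^2 + 18 * a * b * c * d)"

definition cubic_covariant :: "'a::comm_ring_1 poly2 \<Rightarrow> 'a poly2" where
  "cubic_covariant g =
    (let a = coeff (coeff g 0) 3; b = coeff (coeff g 1) 2;
         c = coeff (coeff g 2) 1; d = coeff (coeff g 3) 0
     in cubic_form
          (2 * b^3 + 27 * a^2 * d - 9 * a * b * c)
          (3 * (b^2 * c + 9 * a * b * d - 6 * a * c^2))
          (- 3 * (b * c^2 + 9 * a * c * d - 6 * b^2 * d))
          (- (2 * c^3 + 27 * a * d^2 - 9 * b * c * d)))"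

text \<open>\<open>M $ i $ j\<close> is the entry in row \<open>i\<close> and column \<open>j\<close>.\<close>

definition act :: "'a::field poly2 \<Rightarrow> 'a^2^2 \<Rightarrow> 'a poly2" where
  "act g M =
     Const_2 (inverse (det M)) *
     subst2 Const_2 g
       (Const_2 (M $ 1 $ 1) * Var_X + Const_2 (M $ 2 $ 1) * Var_Y)
       (Const_2 (M $ 1 $ 2) * Var_X + Const_2 (M $ 2 $ 2) * Var_Y)"

definition SL2_equivalent :: "'a::field poly2 \<Rightarrow> 'a poly2 \<Rightarrow> bool" where
  "SL2_equivalent g1 g2 \<longleftrightarrow> (\<exists>M. det M = 1 \<and> g2 = act g1 M)"

definition B_poly :: "'a::comm_ring_1 poly2 \<Rightarrow> 'a poly2 \<Rightarrow> 'a poly4" where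
  "B_poly g1 g2 =
     subst2 Const_4 g2 Var_X2 Var_Y2 * subst2 Const_4 (cubic_covariant g1) Var_X1 Var_Y1
     - subst2 Const_4 (cubic_covariant g2) Var_X2 Var_Y2 * subst2 Const_4 g1 Var_X1 Var_Y1"

definition bihomogeneous :: "nat \<Rightarrow> nat \<Rightarrow> 'a::comm_ring_1 poly4 \<Rightarrow> bool" where
  "bihomogeneous m n p \<longleftrightarrow>
     (\<forall>i j k l. coeff (coeff (coeff (coeff p l) k) j) i \<noteq> 0 \<longrightarrow> i + j = m \<and> k + l = n)"

definition has_bilinear_factor :: "'a::comm_ring_1 poly4 \<Rightarrow> bool" where
  "has_bilinear_factor B \<longleftrightarrow> (\<exists>p. p \<noteq> 0 \<and> bihomogeneous 1 1 p \<and> p dvd B)"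

definition bilinear_of :: "'a::comm_ring_1^2^2 \<Rightarrow> 'a poly4" where
  "bilinear_of M =
     - (Const_4 (M $ 1 $ 2) * Var_X1 * Var_X2) + Const_4 (M $ 1 $ 1) * Var_X1 * Var_Y2
     - Const_4 (M $ 2 $ 2) * Var_Y1 * Var_X2 + Const_4 (M $ 2 $ 1) * Var_Y1 * Var_Y2"

text \<open>
  The next two facts show that the matrix of a bilinear factor is determined only up to sign:
  \<open>M\<close> and \<open>- M\<close> give proportional bilinear forms, although they act differently on cubic forms.
\<close>

lemma bilinear_of_uminus:
  fixes M :: "'a::comm_ring_1^2^2"
  shows "bilinear_of (- M) = - bilinear_of M"
proof -
  have "Const_4 (- x) = - Const_4 x" for x :: 'a
    by (simp add: Const_4_def)
  then show ?thesis
    by (simp add: bilinear_of_def)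
qed

lemma subst2_Const_2_cubic_form:
  "subst2 Const_2 (cubic_form a b c d) P Q =
     Const_2 a * P ^ 3 + Const_2 b * P ^ 2 * Q + Const_2 c * P * Q ^ 2 + Const_2 d * Q ^ 3"
proof -
  have "cubic_form a b c d = [:[:0, 0, 0, a:], [:0, 0, b:], [:0, c:], [:d:]:]"
    by (simp add: cubic_form_def Const_2_def Var_X_def Var_Y_def power2_eq_square power3_eq_cube)
  then show ?thesis
    by (simp add: subst2_def map_poly_pCons Const_2_def power2_eq_square power3_eq_cube
        algebra_simps)
qed

lemma act_uminus:
  fixes g :: "'a::field poly2"
  assumes "binary_cubic_form g"
  shows "act g (- M) = - act g M"
proof -
  obtain a b c d where g: "g = cubic_form a b c d"
    using assms by (auto simp: binary_cubic_form_def)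
  have det: "det (- M) = det M"
    by (simp add: det_2)
  have neg: "Const_2 (- x) = - Const_2 x" for x :: 'a
    by (simp add: Const_2_def)
  have lin: "Const_2 ((- M) $ i $ k) * Var_X + Const_2 ((- M) $ j $ k) * Var_Y
      = - (Const_2 (M $ i $ k) * Var_X + Const_2 (M $ j $ k) * Var_Y)" for i j k
    by (simp add: neg)
  show ?thesis
    unfolding act_def g det lin subst2_Const_2_cubic_form
    by (simp add: power2_eq_square power3_eq_cube algebra_simps)
qed

end

theory Submission
  imports Defs
begin

text \<open>
  Write \<open>G\<close> and \<open>H\<close> for the cubic covariant and the Hessian of a cubic \<open>g\<close> of discriminant \<open>D\<close>.
  Two identities drive the proof: the syzygy \<open>G^2 + 27 D g^2 = 4 H^3\<close>, and the formula
  \<open>- 2 X H^2\<close> for the Wronskian of \<open>g\<close> and \<open>G\<close>. If the bilinear form with matrix \<open>N\<close> of determinant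
  \<open>e \<noteq> 0\<close> divides \<open>B\<close>, let \<open>h = g2^N\<close>, with covariant \<open>G'\<close> and Hessian \<open>H'\<close>; substituting the zero
  \<open>(X2, Y2) = (r X1 + t Y1, s X1 + u Y1)\<close> of the form shows that \<open>e h G1 = G' g1\<close>. Differentiating
  \<open>G1 / g1 = G' / (e h)\<close> gives \<open>e h^2 H1^2 = H'^2 g1^2\<close>. Squaring it gives
  \<open>e^2 h^2 H1^3 = H'^3 g1^2\<close>, because \<open>h\<close> has discriminant \<open>e^2 D\<close> and so the discriminant terms
  cancel. Hence \<open>H' = e H1\<close> and \<open>h^2 = e g1^2\<close>, so \<open>h = c g1\<close> with \<open>c^2 = e\<close>, and \<open>N / c\<close> lies in
  \<open>SL2\<close> and maps \<open>g2\<close> to \<open>g1\<close>. If \<open>e = 0\<close>, a nonzero row of \<open>N\<close> is a zero of the bilinear form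
  at which \<open>g2\<close> and \<open>G2\<close> both vanish unless \<open>g1\<close> and \<open>G1\<close> are linearly dependent; neither is
  possible. Conversely, if \<open>g1 = g2^N\<close> with \<open>e = 1\<close>, then \<open>B\<close> is alternating in the points
  \<open>(X2, Y2)\<close> and \<open>(r X1 + t Y1, s X1 + u Y1)\<close>, hence divisible by their determinant, the bilinear
  form.
\<close>

subsection \<open>Binary cubic forms and their covariants\<close>

lemma
  shows Const_2_0: "Const_2 0 = 0" and Const_2_1: "Const_2 1 = 1"
    and Const_2_add: "Const_2 (x + y) = Const_2 x + Const_2 y"
    and Const_2_uminus: "Const_2 (- x) = - Const_2 x"
    and Const_2_diff: "Const_2 (x - y) = Const_2 x - Const_2 y"
    and Const_2_mult: "Const_2 (x * y) = Const_2 x * Const_2 y"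
    and Const_2_power: "Const_2 (x ^ n) = Const_2 x ^ n"
    and Const_2_numeral: "Const_2 (numeral k) = numeral k"
  by (simp_all add: Const_2_def one_pCons poly_const_pow numeral_poly)

lemmas Const_2_hom = Const_2_0 Const_2_1 Const_2_add Const_2_uminus Const_2_diff Const_2_mult
  Const_2_power Const_2_numeral

lemma Const_2_eq_0_iff [simp]: "Const_2 x = 0 \<longleftrightarrow> x = 0"
  by (simp add: Const_2_def)

lemma square_eq_Const_2_mult_squareE:
  fixes p q :: "'a::field poly2"
  assumes "p^2 = Const_2 e * q^2" and "q \<noteq> 0"
  obtains c where "c^2 = e" and "p = Const_2 c * q"
proof -
  define c where "c = lead_coeff (lead_coeff p) / lead_coeff (lead_coeff q)"
  have "lead_coeff (lead_coeff (p^2)) = lead_coeff (lead_coeff (Const_2 e * q^2))"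
    by (simp only: assms(1))
  then have "(lead_coeff (lead_coeff p))^2 = e * (lead_coeff (lead_coeff q))^2"
    by (simp add: lead_coeff_mult lead_coeff_power Const_2_def del: mult_pCons_left)
  then have e: "c^2 = e"
    using \<open>q \<noteq> 0\<close> by (simp add: c_def power_divide field_simps)
  then have "p^2 = (Const_2 c * q)^2"
    using assms(1) by (simp add: power_mult_distrib flip: Const_2_hom)
  then have "p = Const_2 c * q \<or> p = Const_2 (- c) * q"
    by (simp add: power2_eq_iff Const_2_hom)
  with e show thesis
    using that[of c] that[of "- c"] by auto
qed

lemma cubic_form_pCons: "cubic_form a b c d = [:[:0, 0, 0, a:], [:0, 0, b:], [:0, c:], [:d:]:]"
  by (simp add: cubic_form_def Const_2_def Var_X_def Var_Y_def power2_eq_square power3_eq_cube)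

lemma cubic_form_eq_iff:
  "cubic_form a b c d = cubic_form a' b' c' d' \<longleftrightarrow> a = a' \<and> b = b' \<and> c = c' \<and> d = d'"
  by (auto simp: cubic_form_pCons)

lemma binary_cubic_form_cubic_form [simp]: "binary_cubic_form (cubic_form a b c d)"
  by (auto simp: binary_cubic_form_def)

lemma binary_cubic_formE:
  assumes "binary_cubic_form g"
  obtains a b c d where "g = cubic_form a b c d"
  using assms by (auto simp: binary_cubic_form_def)

lemma subst2_cubic_form:
  assumes "h 0 = 0"
  shows "subst2 h (cubic_form a b c d) P Q =
    h a * P ^ 3 + h b * P ^ 2 * Q + h c * P * Q ^ 2 + h d * Q ^ 3"
  using assms
  by (simp add: subst2_def cubic_form_pCons map_poly_pCons eval_nat_numeral algebra_simps)

lemma Const_2_mult_cubic_form: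
  "Const_2 k * cubic_form a b c d = cubic_form (k * a) (k * b) (k * c) (k * d)"
  by (simp add: cubic_form_def Const_2_hom algebra_simps)

lemma cubic_disc_0 [simp]: "cubic_disc 0 = 0"
  by (simp add: cubic_disc_def)

lemma coeff_cubic_form:
  "coeff (coeff (cubic_form a b c d) 0) 3 = a" "coeff (coeff (cubic_form a b c d) 1) 2 = b"
  "coeff (coeff (cubic_form a b c d) 2) 1 = c" "coeff (coeff (cubic_form a b c d) 3) 0 = d"
  by (simp_all add: cubic_form_pCons eval_nat_numeral)

lemma cubic_disc_cubic_form:
  "cubic_disc (cubic_form a b c d) =
     b^2 * c^2 - 4 * a * c^3 - 4 * b^3 * d - 27 * a^2 * d^2 + 18 * a * b * c * d"
  by (simp only: cubic_disc_def coeff_cubic_form Let_def)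

lemma cubic_covariant_cubic_form:
  "cubic_covariant (cubic_form a b c d) =
     cubic_form
       (2 * b^3 + 27 * a^2 * d - 9 * a * b * c)
       (3 * (b^2 * c + 9 * a * b * d - 6 * a * c^2))
       (- 3 * (b * c^2 + 9 * a * c * d - 6 * b^2 * d))
       (- (2 * c^3 + 27 * a * d^2 - 9 * b * c * d))"
  by (simp only: cubic_covariant_def coeff_cubic_form Let_def)

lemma binary_cubic_form_cubic_covariant [simp]: "binary_cubic_form (cubic_covariant g)"
  by (simp add: cubic_covariant_def Let_def)

lemma binary_cubic_form_Const_2_mult:
  assumes "binary_cubic_form g"
  shows "binary_cubic_form (Const_2 k * g)"
  using assms by (elim binary_cubic_formE) (simp add: Const_2_mult_cubic_form)

lemma cubic_disc_Const_2_mult: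
  assumes "binary_cubic_form g"
  shows "cubic_disc (Const_2 k * g) = k^4 * cubic_disc g"
  using assms
  by (elim binary_cubic_formE)
    (simp add: Const_2_mult_cubic_form cubic_disc_cubic_form algebra_simps eval_nat_numeral)

lemma cubic_covariant_Const_2_mult:
  assumes "binary_cubic_form g"
  shows "cubic_covariant (Const_2 k * g) = Const_2 (k^3) * cubic_covariant g"
  using assms
  by (elim binary_cubic_formE)
    (simp add: Const_2_mult_cubic_form cubic_covariant_cubic_form cubic_form_eq_iff
      algebra_simps eval_nat_numeral)

text \<open>Normalized as \<open>- 1 / 4\<close> times the determinant of the matrix of second derivatives.\<close>

definition hessian :: "'a::comm_ring_1 poly2 \<Rightarrow> 'a poly2" where
  "hessian g =
    (let a = coeff (coeff g 0) 3; b = coeff (coeff g 1) 2;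
         c = coeff (coeff g 2) 1; d = coeff (coeff g 3) 0
     in Const_2 (b^2 - 3 * a * c) * Var_X^2 + Const_2 (b * c - 9 * a * d) * Var_X * Var_Y
        + Const_2 (c^2 - 3 * b * d) * Var_Y^2)"

lemma hessian_cubic_form:
  "hessian (cubic_form a b c d) =
     Const_2 (b^2 - 3 * a * c) * Var_X^2 + Const_2 (b * c - 9 * a * d) * Var_X * Var_Y
     + Const_2 (c^2 - 3 * b * d) * Var_Y^2"
  by (simp only: hessian_def coeff_cubic_form Let_def)

lemma cubic_syzygy:
  fixes g :: "'a::idom poly2"
  assumes "binary_cubic_form g"
  shows "(cubic_covariant g)^2 + 27 * Const_2 (cubic_disc g) * g^2 = 4 * (hessian g)^3"
proof -
  obtain a b c d where g: "g = cubic_form a b c d"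
    using assms by (rule binary_cubic_formE)
  show ?thesis
    unfolding g cubic_covariant_cubic_form hessian_cubic_form cubic_disc_cubic_form
    unfolding cubic_form_def Const_2_hom by algebra
qed

lemma hessian_nonzero:
  fixes g :: "'a::idom poly2"
  assumes three: "(3::'a) \<noteq> 0" and cubic: "binary_cubic_form g" and disc: "cubic_disc g \<noteq> 0"
  shows "hessian g \<noteq> 0"
proof
  obtain a b c d where g: "g = cubic_form a b c d"
    using cubic by (rule binary_cubic_formE)
  assume "hessian g = 0"
  then have "b^2 - 3 * a * c = 0" "b * c - 9 * a * d = 0" "c^2 - 3 * b * d = 0"
    by (simp_all add: g hessian_cubic_form Const_2_def Var_X_def Var_Y_def power2_eq_square)
  moreover have "3 * cubic_disc g =
      4 * (b^2 - 3 * a * c) * (c^2 - 3 * b * d) - (b * c - 9 * a * d)^2"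
    unfolding g cubic_disc_cubic_form by algebra
  ultimately show False
    using disc three by simp
qed

subsection \<open>Wronskians and quotients of covariants\<close>

text \<open>On \<open>K[X, Y]\<close>, which is \<open>K[X][Y]\<close>, this is the Wronskian with respect to \<open>Y\<close>.\<close>

definition wronskian :: "'a::idom poly \<Rightarrow> 'a poly \<Rightarrow> 'a poly" where
  "wronskian p q = p * pderiv q - pderiv p * q"

lemma wronskian_eq_if_quotient_eq:
  assumes "h * q = k * p"
  shows "h^2 * wronskian p q = p^2 * wronskian h k"
proof -
  have "pderiv h * q + h * pderiv q = pderiv k * p + k * pderiv p"
    using arg_cong[OF assms, of pderiv] by (simp add: pderiv_mult algebra_simps)
  with assms show ?thesis
    unfolding wronskian_def by algebra
qed

lemma wronskian_Const_2_mult_left: "wronskian (Const_2 k * p) q = Const_2 k * wronskian p q"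
  by (simp add: wronskian_def Const_2_def pderiv_smult algebra_simps)

lemma wronskian_cubic_covariant:
  fixes g :: "'a::idom poly2"
  assumes "binary_cubic_form g"
  shows "wronskian g (cubic_covariant g) = - 2 * Var_X * (hessian g)^2"
proof -
  obtain a b c d where g: "g = cubic_form a b c d"
    using assms by (rule binary_cubic_formE)
  have pderiv: "pderiv (cubic_form a b c d) =
      Const_2 b * Var_X^2 + 2 * Const_2 c * Var_X * Var_Y + 3 * Const_2 d * Var_Y^2"
    for a b c d :: 'a
    by (simp add: cubic_form_pCons pderiv_pCons Const_2_def Var_X_def Var_Y_def power2_eq_square
        numeral_poly)
  show ?thesis
    unfolding wronskian_def g cubic_covariant_cubic_form hessian_cubic_form pderiv
    unfolding cubic_form_def Const_2_hom by algebra
qed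

lemma cubic_covariant_independent:
  fixes g :: "'a::idom poly2"
  assumes two: "(2::'a) \<noteq> 0" and three: "(3::'a) \<noteq> 0"
    and g: "binary_cubic_form g" and "cubic_disc g \<noteq> 0"
    and eq: "Const_2 p * cubic_covariant g = Const_2 q * g"
  shows "p = 0 \<and> q = 0"
proof -
  have "(Const_2 p)^2 * wronskian g (cubic_covariant g) = 0"
    using wronskian_eq_if_quotient_eq[OF eq] by (simp add: wronskian_def Const_2_def)
  moreover have "wronskian g (cubic_covariant g) \<noteq> 0"
    using hessian_nonzero[OF three g] assms(4) two
    by (simp add: wronskian_cubic_covariant[OF g] numeral_poly Var_X_def)
  ultimately have "p = 0"
    by simp
  moreover have "g \<noteq> 0"
    using assms(4) by auto
  ultimately show ?thesis
    using eq by (simp add: Const_2_hom)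
qed

lemma hessian_square_eq_if_covariant_quotient_eq:
  fixes f h :: "'a::idom poly2"
  assumes two: "(2::'a) \<noteq> 0" and f: "binary_cubic_form f" and h: "binary_cubic_form h"
    and "e \<noteq> 0" and eq: "Const_2 e * h * cubic_covariant f = cubic_covariant h * f"
  shows "Const_2 e * h^2 * (hessian f)^2 = (hessian h)^2 * f^2"
proof -
  have "(Const_2 e * h)^2 * wronskian f (cubic_covariant f) =
      f^2 * (Const_2 e * wronskian h (cubic_covariant h))"
    using wronskian_eq_if_quotient_eq[OF eq] by (simp add: wronskian_Const_2_mult_left)
  then have "2 * Var_X * Const_2 e * (Const_2 e * h^2 * (hessian f)^2) =
      2 * Var_X * Const_2 e * ((hessian h)^2 * f^2)"
    unfolding wronskian_cubic_covariant[OF f] wronskian_cubic_covariant[OF h] by algebra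
  moreover have "2 * Var_X * Const_2 e \<noteq> 0"
    using two \<open>e \<noteq> 0\<close> by (simp add: numeral_poly Var_X_def)
  ultimately show ?thesis
    using mult_left_cancel by blast
qed

lemma hessian_cube_eq_if_covariant_quotient_eq:
  fixes f h :: "'a::idom poly2"
  assumes two: "(2::'a) \<noteq> 0" and f: "binary_cubic_form f" and h: "binary_cubic_form h"
    and disc: "cubic_disc h = e^2 * cubic_disc f"
    and eq: "Const_2 e * h * cubic_covariant f = cubic_covariant h * f"
  shows "(Const_2 e)^2 * h^2 * (hessian f)^3 = (hessian h)^3 * f^2"
proof -
  have "2 \<noteq> (0::'a poly2)"
    using two by (simp add: numeral_poly)
  have "2 * (2 * ((Const_2 e)^2 * h^2 * (hessian f)^3)) =
      (Const_2 e * h * cubic_covariant f)^2 + 27 * Const_2 (cubic_disc h) * h^2 * f^2"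
    using cubic_syzygy[OF f] unfolding disc Const_2_hom by algebra
  also have "\<dots> = 2 * (2 * ((hessian h)^3 * f^2))"
    using cubic_syzygy[OF h] eq by algebra
  finally show ?thesis
    by (simp only: mult_left_cancel[OF \<open>2 \<noteq> (0::'a poly2)\<close>])
qed

lemma square_eq_if_covariant_quotient_eq:
  fixes f h :: "'a::idom poly2"
  assumes two: "(2::'a) \<noteq> 0" and three: "(3::'a) \<noteq> 0"
    and f: "binary_cubic_form f" and h: "binary_cubic_form h"
    and disc: "cubic_disc h = e^2 * cubic_disc f" "cubic_disc h \<noteq> 0"
    and eq: "Const_2 e * h * cubic_covariant f = cubic_covariant h * f"
  shows "h^2 = Const_2 e * f^2"
proof -
  have nonzero: "e \<noteq> 0" "hessian f \<noteq> 0" "h \<noteq> 0"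
    using disc hessian_nonzero[OF three f] by auto
  note squares = hessian_square_eq_if_covariant_quotient_eq[OF two f h \<open>e \<noteq> 0\<close> eq]
  note cubes = hessian_cube_eq_if_covariant_quotient_eq[OF two f h disc(1) eq]
  have "(Const_2 e * h^2 * (hessian f)^2) * hessian h = (hessian h)^3 * f^2"
    using squares by algebra
  also have "\<dots> = (Const_2 e * h^2 * (hessian f)^2) * (Const_2 e * hessian f)"
    using cubes by algebra
  finally have "hessian h = Const_2 e * hessian f"
    using nonzero by simp
  with squares have "(Const_2 e * (hessian f)^2) * h^2 =
      (Const_2 e * (hessian f)^2) * (Const_2 e * f^2)"
    by algebra
  then show ?thesis
    using nonzero by simp
qed

subsection \<open>Linear substitutions\<close>

definition column_form :: "'a::comm_ring_1^2^2 \<Rightarrow> 2 \<Rightarrow> 'a poly2" where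
  "column_form M j = Const_2 (M $ 1 $ j) * Var_X + Const_2 (M $ 2 $ j) * Var_Y"

definition linear_subst :: "'a::comm_ring_1 poly2 \<Rightarrow> 'a^2^2 \<Rightarrow> 'a poly2" where
  "linear_subst g M = subst2 Const_2 g (column_form M 1) (column_form M 2)"

lemma act_eq_linear_subst: "act g M = Const_2 (inverse (det M)) * linear_subst g M"
  by (simp add: act_def linear_subst_def column_form_def)

lemma linear_subst_eq_act: "det M \<noteq> 0 \<Longrightarrow> linear_subst g M = Const_2 (det M) * act g M"
  by (simp add: act_eq_linear_subst mult.assoc[symmetric] Const_2_1 flip: Const_2_mult)

lemma linear_subst_cubic_form:
  fixes M :: "'a::comm_ring_1^2^2"
  defines "r \<equiv> M $ 1 $ 1" and "s \<equiv> M $ 1 $ 2" and "t \<equiv> M $ 2 $ 1" and "u \<equiv> M $ 2 $ 2"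
  shows "linear_subst (cubic_form a b c d) M =
    cubic_form
      (a * r^3 + b * r^2 * s + c * r * s^2 + d * s^3)
      (3 * a * r^2 * t + b * (r^2 * u + 2 * r * s * t) + c * (2 * r * s * u + s^2 * t)
        + 3 * d * s^2 * u)
      (3 * a * r * t^2 + b * (s * t^2 + 2 * r * t * u) + c * (2 * s * t * u + r * u^2)
        + 3 * d * s * u^2)
      (a * t^3 + b * t^2 * u + c * t * u^2 + d * u^3)"
  unfolding linear_subst_def subst2_Const_2_cubic_form
  by (simp add: column_form_def cubic_form_def Const_2_hom r_def s_def t_def u_def
      algebra_simps eval_nat_numeral)

lemma binary_cubic_form_linear_subst:
  assumes "binary_cubic_form g"
  shows "binary_cubic_form (linear_subst g M)"
  using assms by (elim binary_cubic_formE) (simp add: linear_subst_cubic_form)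

lemma cubic_disc_linear_subst:
  fixes g :: "'a::idom poly2"
  assumes "binary_cubic_form g"
  shows "cubic_disc (linear_subst g M) = (det M)^6 * cubic_disc g"
proof -
  obtain a b c d where g: "g = cubic_form a b c d"
    using assms by (rule binary_cubic_formE)
  show ?thesis
    unfolding g linear_subst_cubic_form cubic_disc_cubic_form det_2 by algebra
qed

lemma cubic_covariant_linear_subst:
  fixes g :: "'a::idom poly2"
  assumes "binary_cubic_form g"
  shows "cubic_covariant (linear_subst g M) =
    Const_2 ((det M)^3) * linear_subst (cubic_covariant g) M"
proof -
  obtain a b c d where g: "g = cubic_form a b c d"
    using assms by (rule binary_cubic_formE)
  show ?thesis
    unfolding g linear_subst_cubic_form cubic_covariant_cubic_form Const_2_mult_cubic_form
      cubic_form_eq_iff det_2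
    by (intro conjI; algebra)
qed

lemma linear_subst_Const_2_mult:
  assumes "binary_cubic_form g"
  shows "linear_subst (Const_2 k * g) M = Const_2 k * linear_subst g M"
  using assms
  by (elim binary_cubic_formE)
    (simp add: Const_2_mult_cubic_form linear_subst_def subst2_Const_2_cubic_form Const_2_hom
      algebra_simps)

lemma linear_subst_linear_subst:
  fixes g :: "'a::idom poly2"
  assumes "binary_cubic_form g"
  shows "linear_subst (linear_subst g M) N = linear_subst g (N ** M)"
proof -
  obtain a b c d where g: "g = cubic_form a b c d"
    using assms by (rule binary_cubic_formE)
  have product: "(N ** M) $ i $ j = N $ i $ 1 * M $ 1 $ j + N $ i $ 2 * M $ 2 $ j" for i j
    by (simp add: matrix_matrix_mult_def sum_2)
  show ?thesis
    unfolding g linear_subst_cubic_form cubic_form_eq_iff product by (intro conjI; algebra)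
qed

lemma linear_subst_mat:
  assumes "binary_cubic_form g"
  shows "linear_subst g (mat k) = Const_2 (k^3) * g"
proof -
  obtain a b c d where g: "g = cubic_form a b c d"
    using assms by (rule binary_cubic_formE)
  show ?thesis
    unfolding g linear_subst_cubic_form Const_2_mult_cubic_form cubic_form_eq_iff
    by (simp add: mat_def mult.commute eval_nat_numeral)
qed

lemma binary_cubic_form_act:
  assumes "binary_cubic_form g"
  shows "binary_cubic_form (act g M)"
  using assms
  by (simp add: act_eq_linear_subst binary_cubic_form_Const_2_mult binary_cubic_form_linear_subst)

lemma cubic_disc_act:
  assumes "binary_cubic_form g"
  shows "cubic_disc (act g M) = (det M)^2 * cubic_disc g"
proof -
  have "cubic_disc (act g M) = ((inverse (det M))^4 * (det M)^6) * cubic_disc g"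
    using assms
    by (simp add: act_eq_linear_subst cubic_disc_Const_2_mult binary_cubic_form_linear_subst
        cubic_disc_linear_subst)
  also have "(inverse (det M))^4 * (det M)^6 = (det M)^2"
    by (cases "det M = 0") (simp_all add: field_simps eval_nat_numeral)
  finally show ?thesis .
qed

lemma cubic_covariant_act:
  assumes "binary_cubic_form g" and "det M \<noteq> 0"
  shows "cubic_covariant (act g M) = linear_subst (cubic_covariant g) M"
proof -
  have "cubic_covariant (act g M) =
      Const_2 ((inverse (det M))^3 * (det M)^3) * linear_subst (cubic_covariant g) M"
    using assms(1)
    by (simp add: act_eq_linear_subst cubic_covariant_Const_2_mult binary_cubic_form_linear_subst
        cubic_covariant_linear_subst Const_2_mult)
  also have "(inverse (det M))^3 * (det M)^3 = 1"
    using \<open>det M \<noteq> 0\<close> by (simp flip: power_mult_distrib)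
  finally show ?thesis
    by (simp add: Const_2_hom)
qed

lemma act_act:
  assumes "binary_cubic_form g"
  shows "act (act g M) N = act g (N ** M)"
proof -
  have "act (act g M) N =
      Const_2 (inverse (det N) * inverse (det M)) * linear_subst g (N ** M)"
    using assms
    by (simp add: act_eq_linear_subst linear_subst_Const_2_mult binary_cubic_form_linear_subst
        linear_subst_linear_subst Const_2_mult)
  then show ?thesis
    by (simp add: act_eq_linear_subst det_mul)
qed

lemma det_mat_2: "det (mat k :: 'a::comm_ring_1^2^2) = k^2"
  by (simp add: det_2 mat_def power2_eq_square)

lemma act_mat:
  assumes "binary_cubic_form g" and "k \<noteq> 0"
  shows "act g (mat k) = Const_2 k * g"
proof -
  have "inverse (k^2) * k^3 = k"
    using \<open>k \<noteq> 0\<close> by (simp add: field_simps eval_nat_numeral)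
  then show ?thesis
    using assms
    by (simp add: act_eq_linear_subst det_mat_2 linear_subst_mat mult.assoc[symmetric]
        flip: Const_2_mult)
qed

lemma SL2_equivalent_sym:
  assumes "binary_cubic_form g1" and "SL2_equivalent g1 g2"
  shows "SL2_equivalent g2 g1"
proof -
  obtain M where M: "det M = 1" "g2 = act g1 M"
    using assms(2) by (auto simp: SL2_equivalent_def)
  then obtain N where N: "N ** M = mat 1"
    using invertible_det_nz[of M] by (auto simp: invertible_def)
  have "det N = 1"
    using arg_cong[OF N, of det] by (simp add: det_mul M(1))
  moreover have "act g2 N = g1"
    by (simp add: M(2) act_act assms(1) N act_mat Const_2_hom)
  ultimately show ?thesis
    by (auto simp: SL2_equivalent_def)
qed

lemma SL2_equivalent_if_act_proportional:
  assumes g1: "binary_cubic_form g1" and g2: "binary_cubic_form g2"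
    and det: "c^2 = det N" and act: "act g2 N = Const_2 c * g1" and "c \<noteq> 0"
  shows "SL2_equivalent g2 g1"
proof -
  define M where "M = mat (inverse c) ** N"
  have "det M = (inverse c * c)^2"
    by (simp only: M_def det_mul det_mat_2 det[symmetric] power_mult_distrib)
  then have "det M = 1"
    using \<open>c \<noteq> 0\<close> by simp
  moreover have "act g2 M = Const_2 (inverse c) * (Const_2 c * g1)"
    using g1 \<open>c \<noteq> 0\<close>
    by (simp add: M_def act_act[OF g2, symmetric] act act_mat binary_cubic_form_Const_2_mult)
  then have "act g2 M = g1"
    using \<open>c \<noteq> 0\<close> by (simp add: Const_2_1 flip: mult.assoc Const_2_mult)
  ultimately show ?thesis
    by (auto simp: SL2_equivalent_def)
qed

lemma cubic_covariant_no_common_zero: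
  fixes g :: "'a::field poly2"
  assumes two: "(2::'a) \<noteq> 0" and g: "binary_cubic_form g" and "cubic_disc g \<noteq> 0"
    and "subst2 id g x y = 0" and "subst2 id (cubic_covariant g) x y = 0"
  shows "x = 0 \<and> y = 0"
proof (rule ccontr)
  assume "\<not> (x = 0 \<and> y = 0)"
  \<comment> \<open>Moving \<open>(x, y)\<close> to \<open>(1, 0)\<close> by \<open>SL2\<close> turns values into leading coefficients.\<close>
  define z w where "z = (if x = 0 then - 1 / y else 0)" and "w = (if x = 0 then 0 else 1 / x)"
  define M :: "'a^2^2" where "M = vector [vector [x, y], vector [z, w]]"
  have det: "det M = 1"
    using \<open>\<not> (x = 0 \<and> y = 0)\<close> by (auto simp: M_def det_2 z_def w_def)
  obtain a b c d where h: "linear_subst g M = cubic_form a b c d"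
    using binary_cubic_form_linear_subst[OF g] by (rule binary_cubic_formE)
  have lead: "coeff (coeff (linear_subst f M) 0) 3 = subst2 id f x y" if "binary_cubic_form f" for f
    using that
    by (elim binary_cubic_formE)
      (simp add: linear_subst_cubic_form coeff_cubic_form subst2_cubic_form M_def)
  have "a = 0"
    using lead[OF g] assms(4) by (simp add: h coeff_cubic_form)
  moreover have "coeff (coeff (cubic_covariant (cubic_form a b c d)) 0) 3 = 0"
    using lead[of "cubic_covariant g"] assms(5) cubic_covariant_linear_subst[OF g, of M]
    by (simp add: h det Const_2_hom)
  ultimately have "a = 0" "b = 0"
    using two by (simp_all add: cubic_covariant_cubic_form coeff_cubic_form)
  then have "cubic_disc (linear_subst g M) = 0"
    by (simp add: h cubic_disc_cubic_form)
  with \<open>cubic_disc g \<noteq> 0\<close> show False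
    by (simp add: cubic_disc_linear_subst g det)
qed

subsection \<open>Evaluating \<open>B\<close> at the zeros of a bilinear form\<close>

lemma hom_poly:
  fixes k :: "'a::comm_ring_1 \<Rightarrow> 'b::comm_ring_1"
  assumes add: "\<And>x y. k (x + y) = k x + k y" and mult: "\<And>x y. k (x * y) = k x * k y"
  shows "k (poly p x) = poly (map_poly k p) (k x)"
proof -
  have "k 0 = 0"
    using add[of 0 0] by simp
  then show ?thesis
    by (induction p) (simp_all add: map_poly_pCons add mult)
qed

lemma subst2_hom:
  fixes k :: "'b::comm_ring_1 \<Rightarrow> 'c::comm_ring_1"
  assumes add: "\<And>x y. k (x + y) = k x + k y" and mult: "\<And>x y. k (x * y) = k x * k y"
    and "h 0 = 0" and "\<And>x. k (h x) = h' x"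
  shows "k (subst2 h g P Q) = subst2 h' g (k P) (k Q)"
proof -
  have "k 0 = 0"
    using add[of 0 0] by simp
  with assms(3,4) show ?thesis
    by (simp add: subst2_def hom_poly[of k, OF add mult] map_poly_map_poly o_def)
qed

lemma subst2_Const_2_Var:
  assumes "binary_cubic_form g"
  shows "subst2 Const_2 g Var_X Var_Y = g"
proof -
  obtain a b c d where g: "g = cubic_form a b c d"
    using assms by (rule binary_cubic_formE)
  show ?thesis
    unfolding g subst2_Const_2_cubic_form by (simp add: cubic_form_def)
qed

lemma subst2_Const_2_Const_2: "subst2 Const_2 g (Const_2 x) (Const_2 y) = Const_2 (subst2 id g x y)"
  by (rule subst2_hom[symmetric]) (simp_all add: Const_2_hom)

lemma subst2_Const_4_pCons: "subst2 Const_4 g [:[:P:]:] [:[:Q:]:] = [:[:subst2 Const_2 g P Q:]:]"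
  by (rule subst2_hom[symmetric]) (simp_all add: Const_2_def Const_4_def)

text \<open>Here \<open>K[X1, Y1]\<close> is identified with \<open>K[X, Y]\<close>.\<close>

definition eval_X2_Y2 :: "'a::comm_ring_1 poly4 \<Rightarrow> 'a poly2 \<Rightarrow> 'a poly2 \<Rightarrow> 'a poly2" where
  "eval_X2_Y2 p P Q = poly (poly p [:Q:]) P"

lemma eval_X2_Y2_dvd:
  assumes "p dvd q" and "eval_X2_Y2 p P Q = 0"
  shows "eval_X2_Y2 q P Q = 0"
  using assms by (auto simp: eval_X2_Y2_def elim!: dvdE)

lemma eval_X2_Y2_B_poly:
  assumes "binary_cubic_form g1"
  shows "eval_X2_Y2 (B_poly g1 g2) P Q =
    subst2 Const_2 g2 P Q * cubic_covariant g1 - subst2 Const_2 (cubic_covariant g2) P Q * g1"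
proof -
  have "eval_X2_Y2 (subst2 Const_4 g V W) P Q =
      subst2 Const_2 g (eval_X2_Y2 V P Q) (eval_X2_Y2 W P Q)" for g and V W :: "'a poly4"
    by (rule subst2_hom) (simp_all add: eval_X2_Y2_def Const_4_def Const_2_def)
  then have "eval_X2_Y2 (subst2 Const_4 g Var_X1 Var_Y1) P Q = subst2 Const_2 g Var_X Var_Y"
    "eval_X2_Y2 (subst2 Const_4 g Var_X2 Var_Y2) P Q = subst2 Const_2 g P Q" for g
    by (simp_all add: eval_X2_Y2_def Var_X1_def Var_Y1_def Var_X2_def Var_Y2_def Var_X_def
        Var_Y_def)
  moreover have "eval_X2_Y2 (p * q - p' * q') P Q = eval_X2_Y2 p P Q * eval_X2_Y2 q P Q
      - eval_X2_Y2 p' P Q * eval_X2_Y2 q' P Q" for p q p' q' :: "'a poly4"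
    by (simp add: eval_X2_Y2_def)
  ultimately show ?thesis
    using assms by (simp add: B_poly_def subst2_Const_2_Var)
qed

lemma bilinear_of_column_form:
  "bilinear_of M = [:[:column_form M 1:]:] * Var_Y2 - [:[:column_form M 2:]:] * Var_X2"
  by (simp add: bilinear_of_def column_form_def Const_4_def Const_2_def Var_X1_def Var_Y1_def
      Var_X2_def Var_Y2_def Var_X_def Var_Y_def)

lemma eval_X2_Y2_bilinear_of:
  "eval_X2_Y2 (bilinear_of M) P Q = column_form M 1 * Q - column_form M 2 * P"
  by (simp add: eval_X2_Y2_def bilinear_of_column_form Var_X2_def Var_Y2_def)

lemma bilinear_of_pCons:
  "bilinear_of M =
     [:[:0, [:[:0, - M $ 1 $ 2:], [:- M $ 2 $ 2:]:]:], [:[:[:0, M $ 1 $ 1:], [:M $ 2 $ 1:]:]:]:]"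
  by (simp add: bilinear_of_def Const_4_def Var_X1_def Var_Y1_def Var_X2_def Var_Y2_def)

lemma bilinear_of_eq_0_iff: "bilinear_of M = 0 \<longleftrightarrow> M = 0"
  by (auto simp: bilinear_of_pCons vec_eq_iff forall_2)

lemma bihomogeneous_bilinear_of: "bihomogeneous 1 1 (bilinear_of M)"
  by (auto simp: bihomogeneous_def bilinear_of_pCons coeff_pCons split: nat.splits)

lemma bihomogeneous_1_1E:
  fixes p :: "'a::comm_ring_1 poly4"
  assumes "bihomogeneous 1 1 p"
  obtains M where "p = bilinear_of M"
proof -
  define coef where "coef i j k l = coeff (coeff (coeff (coeff p l) k) j) i" for i j k l
  define M :: "'a^2^2" where "M = vector
    [vector [coef 1 0 0 1, - coef 1 0 1 0], vector [coef 0 1 0 1, - coef 0 1 1 0]]"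
  have zero: "coef i j k l = 0" if "i + j \<noteq> 1 \<or> k + l \<noteq> 1" for i j k l
    using assms that unfolding bihomogeneous_def coef_def by blast
  have "coef i j k l = coeff (coeff (coeff (coeff (bilinear_of M) l) k) j) i" for i j k l
  proof (cases "i + j = 1 \<and> k + l = 1")
    case True
    then have "(i = 0 \<and> j = 1 \<or> i = 1 \<and> j = 0) \<and> (k = 0 \<and> l = 1 \<or> k = 1 \<and> l = 0)"
      by auto
    then show ?thesis
      by (auto simp: bilinear_of_pCons M_def)
  next
    case False
    then show ?thesis
      by (subst zero) (auto simp: bilinear_of_pCons coeff_pCons split: nat.splits)
  qed
  then show thesis
    by (intro that[of M] poly_eqI) (simp add: coef_def)
qed

subsection \<open>Bilinear factors of \<open>B\<close>\<close>

lemma bilinear_factor_imp_proportional: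
  fixes g1 g2 :: "'a::field poly2"
  assumes two: "(2::'a) \<noteq> 0" and three: "(3::'a) \<noteq> 0"
    and g1: "binary_cubic_form g1" and g2: "binary_cubic_form g2"
    and disc: "cubic_disc g1 = cubic_disc g2" "cubic_disc g2 \<noteq> 0"
    and dvd: "bilinear_of N dvd B_poly g1 g2" and det: "det N \<noteq> 0"
  obtains c where "c^2 = det N" and "act g2 N = Const_2 c * g1"
proof -
  define h where "h = act g2 N"
  have h: "binary_cubic_form h"
    using g2 by (simp add: h_def binary_cubic_form_act)
  have "eval_X2_Y2 (B_poly g1 g2) (column_form N 1) (column_form N 2) = 0"
    by (rule eval_X2_Y2_dvd[OF dvd]) (simp add: eval_X2_Y2_bilinear_of)
  then have "Const_2 (det N) * h * cubic_covariant g1 = cubic_covariant h * g1"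
    using g1 g2 det
    by (simp add: eval_X2_Y2_B_poly linear_subst_eq_act h_def cubic_covariant_act
        flip: linear_subst_def)
  moreover have "cubic_disc h = (det N)^2 * cubic_disc g1" "cubic_disc h \<noteq> 0"
    using g2 disc det by (simp_all add: h_def cubic_disc_act)
  ultimately have "h^2 = Const_2 (det N) * g1^2"
    by (intro square_eq_if_covariant_quotient_eq two three g1 h)
  moreover have "g1 \<noteq> 0"
    using disc by auto
  ultimately show thesis
    using that unfolding h_def by (rule square_eq_Const_2_mult_squareE)
qed

lemma bilinear_factor_det_nonzero:
  fixes g1 g2 :: "'a::field poly2"
  assumes two: "(2::'a) \<noteq> 0" and three: "(3::'a) \<noteq> 0"
    and g1: "binary_cubic_form g1" and g2: "binary_cubic_form g2"
    and "cubic_disc g1 \<noteq> 0" and "cubic_disc g2 \<noteq> 0"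
    and dvd: "bilinear_of N dvd B_poly g1 g2" and "N \<noteq> 0"
  shows "det N \<noteq> 0"
proof
  assume "det N = 0"
  obtain i where row: "\<not> (N $ i $ 1 = 0 \<and> N $ i $ 2 = 0)"
    using \<open>N \<noteq> 0\<close> by (auto simp: vec_eq_iff forall_2)
  define x y where "x = N $ i $ 1" and "y = N $ i $ 2"
  have "N $ j $ 1 * y = N $ j $ 2 * x" for j
    using \<open>det N = 0\<close> exhaust_2[of i] exhaust_2[of j]
    by (auto simp: x_def y_def det_2 mult.commute)
  then have "column_form N 1 * Const_2 y = column_form N 2 * Const_2 x"
    by (simp add: column_form_def algebra_simps flip: Const_2_hom)
  then have "eval_X2_Y2 (B_poly g1 g2) (Const_2 x) (Const_2 y) = 0"
    by (intro eval_X2_Y2_dvd[OF dvd]) (simp add: eval_X2_Y2_bilinear_of)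
  then have "Const_2 (subst2 id g2 x y) * cubic_covariant g1 =
      Const_2 (subst2 id (cubic_covariant g2) x y) * g1"
    using g1 by (simp add: eval_X2_Y2_B_poly subst2_Const_2_Const_2)
  then have "subst2 id g2 x y = 0 \<and> subst2 id (cubic_covariant g2) x y = 0"
    by (rule cubic_covariant_independent[OF two three g1 assms(5)])
  then have "x = 0 \<and> y = 0"
    using cubic_covariant_no_common_zero[OF two g2 assms(6)] by blast
  with row show False
    by (simp add: x_def y_def)
qed

lemma det_dvd_alternating_cubic_forms:
  assumes "h 0 = 0" and "binary_cubic_form f" and "binary_cubic_form g"
  shows "P * y - Q * x dvd subst2 h f x y * subst2 h g P Q - subst2 h g x y * subst2 h f P Q"
proof -
  obtain a b c d a' b' c' d' where fg: "f = cubic_form a b c d" "g = cubic_form a' b' c' d'"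
    using assms(2,3) by (metis binary_cubic_formE)
  \<comment> \<open>The cofactor is the Bezoutian of \<open>f\<close> and \<open>g\<close>.\<close>
  have "subst2 h f x y * subst2 h g P Q - subst2 h g x y * subst2 h f P Q =
    (P * y - Q * x) * - ((h a * h b' - h b * h a') * x^2 * P^2
      + (h b * h c' - h c * h b') * x * y * P * Q
      + (h c * h d' - h d * h c') * y^2 * Q^2
      + (h a * h c' - h c * h a') * x * P * (x * Q + y * P)
      + (h b * h d' - h d * h b') * y * Q * (x * Q + y * P)
      + (h a * h d' - h d * h a') * ((x * Q)^2 + x * Q * y * P + (y * P)^2))"
    unfolding fg subst2_cubic_form[of h, OF assms(1)]
    by (simp add: algebra_simps eval_nat_numeral)
  then show ?thesis
    by (rule dvdI)
qed

lemma bilinear_of_dvd_B_poly_act: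
  fixes g :: "'a::field poly2"
  assumes g: "binary_cubic_form g" and det: "det M = 1"
  shows "bilinear_of M dvd B_poly (act g M) g"
proof -
  have subst: "subst2 Const_4 (linear_subst f M) Var_X1 Var_Y1 =
      subst2 Const_4 f [:[:column_form M 1:]:] [:[:column_form M 2:]:]"
    if "binary_cubic_form f" for f
  proof -
    have "subst2 Const_4 (linear_subst f M) [:[:Var_X:]:] [:[:Var_Y:]:] = [:[:linear_subst f M:]:]"
      using that
      by (simp add: subst2_Const_4_pCons subst2_Const_2_Var binary_cubic_form_linear_subst)
    then show ?thesis
      by (simp add: subst2_Const_4_pCons linear_subst_def Var_X1_def Var_Y1_def Var_X_def Var_Y_def)
  qed
  have "act g M = linear_subst g M" "cubic_covariant (act g M) = linear_subst (cubic_covariant g) M"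
    using assms by (simp_all add: act_eq_linear_subst cubic_covariant_linear_subst Const_2_hom)
  then show ?thesis
    unfolding B_poly_def bilinear_of_column_form
    by (simp only: subst g binary_cubic_form_cubic_covariant)
      (rule det_dvd_alternating_cubic_forms; simp add: g Const_4_def)
qed

lemma of_nat_prime_neq_0:
  assumes "prime p" and "CHAR('a::semiring_1) \<noteq> p"
  shows "of_nat p \<noteq> (0::'a)"
  using assms by (auto simp: of_nat_eq_0_iff_char_dvd prime_nat_iff)

theorem has_bilinear_factor_iff_SL2_equivalent:
  fixes g1 g2 :: "'a::field poly2"
  assumes two: "(2::'a) \<noteq> 0" and three: "(3::'a) \<noteq> 0"
    and g1: "binary_cubic_form g1" and g2: "binary_cubic_form g2"
    and disc: "cubic_disc g1 = cubic_disc g2" "cubic_disc g2 \<noteq> 0"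
  shows "has_bilinear_factor (B_poly g1 g2) \<longleftrightarrow> SL2_equivalent g1 g2"
proof
  assume "has_bilinear_factor (B_poly g1 g2)"
  then obtain N where "N \<noteq> 0" and N: "bilinear_of N dvd B_poly g1 g2"
    unfolding has_bilinear_factor_def by (metis bihomogeneous_1_1E bilinear_of_eq_0_iff)
  have det: "det N \<noteq> 0"
    using bilinear_factor_det_nonzero[OF two three g1 g2 _ _ N \<open>N \<noteq> 0\<close>] disc by simp
  obtain c where c: "c^2 = det N" "act g2 N = Const_2 c * g1"
    using bilinear_factor_imp_proportional[OF two three g1 g2 disc N det] .
  moreover have "c \<noteq> 0"
    using c(1) det by auto
  ultimately have "SL2_equivalent g2 g1"
    by (intro SL2_equivalent_if_act_proportional[OF g1 g2])
  then show "SL2_equivalent g1 g2"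
    by (rule SL2_equivalent_sym[OF g2])
next
  assume "SL2_equivalent g1 g2"
  then obtain M where M: "det M = 1" "g1 = act g2 M"
    using SL2_equivalent_sym[OF g1] by (auto simp: SL2_equivalent_def)
  then have "bilinear_of M \<noteq> 0"
    by (auto simp: bilinear_of_eq_0_iff det_2)
  then show "has_bilinear_factor (B_poly g1 g2)"
    using bilinear_of_dvd_B_poly_act[OF g2 M(1)] bihomogeneous_bilinear_of M(2)
    unfolding has_bilinear_factor_def by blast
qed

theorem bilinear_of_dvd_B_poly_iff:
  fixes g1 g2 :: "'a::field poly2"
  assumes two: "(2::'a) \<noteq> 0" and three: "(3::'a) \<noteq> 0"
    and g1: "binary_cubic_form g1" and g2: "binary_cubic_form g2"
    and disc: "cubic_disc g1 = cubic_disc g2" "cubic_disc g2 \<noteq> 0"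
    and det: "det M = 1"
  shows "bilinear_of M dvd B_poly g1 g2 \<longleftrightarrow> g1 = act g2 M \<or> g1 = act g2 (- M)"
proof
  assume dvd: "bilinear_of M dvd B_poly g1 g2"
  have "det M \<noteq> 0"
    using det by simp
  then obtain c where "c^2 = 1" "act g2 M = Const_2 c * g1"
    using bilinear_factor_imp_proportional[OF two three g1 g2 disc dvd] det by metis
  then have "act g2 M = g1 \<or> act g2 M = - g1"
    by (auto simp: power2_eq_1_iff Const_2_hom)
  then show "g1 = act g2 M \<or> g1 = act g2 (- M)"
    using act_uminus[OF g2] by auto
next
  have "det (- M) = 1"
    using det by (simp add: det_2)
  then have "bilinear_of M dvd B_poly (act g2 (- M)) g2"
    using bilinear_of_dvd_B_poly_act[OF g2, of "- M"] by (simp add: bilinear_of_uminus)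
  then show "bilinear_of M dvd B_poly g1 g2" if "g1 = act g2 M \<or> g1 = act g2 (- M)"
    using that bilinear_of_dvd_B_poly_act[OF g2 det] by auto
qed

lemma Const_4_mult_dvd_iff:
  fixes c :: "'a::field"
  assumes "c \<noteq> 0"
  shows "Const_4 c * p dvd q \<longleftrightarrow> p dvd q"
proof -
  have "1 = Const_4 c * Const_4 (inverse c)"
    using assms by (simp add: Const_4_def one_pCons)
  then have "Const_4 c dvd 1"
    by (rule dvdI)
  then show ?thesis
    by (rule mult_unit_dvd_iff')
qed

theorem theorem1p2:
  fixes g1 g2 :: "'a::field poly poly"
  assumes "CHAR('a) \<noteq> 2" and "CHAR('a) \<noteq> 3"
    and "binary_cubic_form g1" and "binary_cubic_form g2"
    and "cubic_disc g1 = cubic_disc g2" and "cubic_disc g2 \<noteq> 0"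
  shows "(has_bilinear_factor (B_poly g1 g2) \<longleftrightarrow> SL2_equivalent g1 g2) \<and>
    (\<forall>M :: 'a^2^2. det M = 1 \<longrightarrow>
       ((\<exists>c. c \<noteq> 0 \<and> Const_4 c * bilinear_of M dvd B_poly g1 g2) \<longleftrightarrow>
        (g1 = act g2 M \<or> g1 = act g2 (- M))))"
proof -
  have two_three: "(2::'a) \<noteq> 0" "(3::'a) \<noteq> 0"
    using of_nat_prime_neq_0[of 2] of_nat_prime_neq_0[of 3] assms(1,2) by simp_all
  have "(\<exists>c. c \<noteq> 0 \<and> Const_4 c * bilinear_of M dvd B_poly g1 g2) \<longleftrightarrow>
      bilinear_of M dvd B_poly g1 g2" for M :: "'a^2^2"
    using Const_4_mult_dvd_iff[of _ "bilinear_of M"] by (metis zero_neq_one)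
  then show ?thesis
    using has_bilinear_factor_iff_SL2_equivalent[OF two_three assms(3-6)]
      bilinear_of_dvd_B_poly_iff[OF two_three assms(3-6)] by simp
qed

end
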